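(* Suppose $A=[a_{ij}]\in\mathbb{R}^{n\times n}$, $n\ge 2$, is a Type-I bdsw matrix with $a_{n1}<0$ and $a_{nn}>0$. Let the $k$th row of $A$, $k\ne n$, be nonnegative. Then the following statements are equivalent: (i) $A\in\mathbf{Q}$. (ii) One of the following holds: (a) The diagonal of $A$ is positive. (b) $a_{kk}=0$, $a_{k(k+1)}>0$, and for all $i\ne k$ the diagonal entry $a_{ii}$ is positive and the relevant off-diagonal entry of row $i$ is negative (that is, $a_{i(i+1)}<0$ for $i\neq k$, $i\le n-1$, where for $i=n$ the relevant entry is $a_{n1}$). (iii) $A\in\mathbf{R}^*$.
   Context: A matrix $A=[a_{ij}]\in\mathbb{R}^{n\times n}$, $n\ge 2$, is a bidiagonal southwest (bdsw) matrix if $a_{ij}=0$ unless $j=i$, or $j=i+1$, or $(i,j)=(n,1)$; the entries in these positions are arbitrary real numbers (possibly zero). In row $i<n$ the relevant off-diagonal entry is $a_{i(i+1)}$; in row $n$ it is $a_{n1}$. A Type-I bdsw matrix is a bdsw matrix that contains at least one (nonzero) nonnegative row; standing assumption: every row of the bdsw matrix has a positive entry (no row is nonpositive). For $A\in\mathbb{R}^{n\times n}$ and $q\in\mathbb{R}^n$, $\mathrm{LCP}(A,q)$ is the problem of finding $x\in\mathbb{R}^n$ with $x\ge 0$, $Ax+q\ge 0$ and $x^\top(Ax+q)=0$ (inequalities between vectors are componentwise; $d>0$ means all components of $d$ are positive). - $A\in\mathbf{Q}$ if $\mathrm{LCP}(A,q)$ has a solution for every $q\in\mathbb{R}^n$.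 - $A\in\mathbf{R}_0$ if $x=0$ is the only solution of $\mathrm{LCP}(A,0)$. - $A\in\mathbf{E}_0$ if for every $d>0$ in $\mathbb{R}^n$, $x=0$ is the only solution of $\mathrm{LCP}(A,d)$. - $A\in\mathbf{R}^*$ if $A\in\mathbf{R}_0$ and $A\in\mathbf{E}_0$. *)

theory Defs
  imports Complex_Main "Jordan_Normal_Form.Matrix"
begin

text \<open>
  Matrices and vectors of \<^theory>\<open>Jordan_Normal_Form.Matrix\<close> are indexed from 0, so row \<open>i\<close> of the
  literature is row \<open>i - 1\<close> here; in particular \<open>a\<^sub>n\<^sub>1\<close> is \<open>A $$ (n - 1, 0)\<close>.
  The order \<open>\<le>\<close> on \<^typ>\<open>real vec\<close> is componentwise and forces equal dimensions, but the
  library's \<open>v < w\<close> only means \<open>v \<le> w \<and> v \<noteq> w\<close>; hence the separate \<open>positive_vec\<close>.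
\<close>

definition positive_vec :: "real vec \<Rightarrow> bool" where
  "positive_vec d \<longleftrightarrow> (\<forall>i < dim_vec d. d $ i > 0)"

definition LCP :: "real mat \<Rightarrow> real vec \<Rightarrow> real vec set" where
  "LCP A q = {x \<in> carrier_vec (dim_vec q).
     x \<ge> 0\<^sub>v (dim_vec q) \<and> A *\<^sub>v x + q \<ge> 0\<^sub>v (dim_vec q) \<and> x \<bullet> (A *\<^sub>v x + q) = 0}"

definition Q_class :: "nat \<Rightarrow> real mat set" where
  "Q_class n = {A \<in> carrier_mat n n. \<forall>q \<in> carrier_vec n. LCP A q \<noteq> {}}"

definition R0_class :: "nat \<Rightarrow> real mat set" where
  "R0_class n = {A \<in> carrier_mat n n. LCP A (0\<^sub>v n) = {0\<^sub>v n}}"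

definition E0_class :: "nat \<Rightarrow> real mat set" where
  "E0_class n = {A \<in> carrier_mat n n. \<forall>d \<in> carrier_vec n. positive_vec d \<longrightarrow> LCP A d = {0\<^sub>v n}}"

definition Rstar_class :: "nat \<Rightarrow> real mat set" where
  "Rstar_class n = R0_class n \<inter> E0_class n"

definition bdsw :: "nat \<Rightarrow> real mat \<Rightarrow> bool" where
  "bdsw n A \<longleftrightarrow> n \<ge> 2 \<and> A \<in> carrier_mat n n \<and>
     (\<forall>i < n. \<forall>j < n. \<not> (j = i \<or> j = i + 1 \<or> (i = n - 1 \<and> j = 0)) \<longrightarrow> A $$ (i, j) = 0)"

definition offdiag :: "nat \<Rightarrow> real mat \<Rightarrow> nat \<Rightarrow> real" where
  "offdiag n A i = (if i = n - 1 then A $$ (n - 1, 0) else A $$ (i, i + 1))"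

definition nonneg_row :: "real mat \<Rightarrow> nat \<Rightarrow> bool" where
  "nonneg_row A i \<longleftrightarrow> row A i \<ge> 0\<^sub>v (dim_col A)"

definition type_I_bdsw :: "nat \<Rightarrow> real mat \<Rightarrow> bool" where
  "type_I_bdsw n A \<longleftrightarrow> bdsw n A \<and> (\<exists>i < n. nonneg_row A i \<and> row A i \<noteq> 0\<^sub>v n)"

end

theory Submission
  imports Defs
begin

text \<open>
  Write \<open>d\<^sub>i\<close> and \<open>b\<^sub>i\<close> for the diagonal and the relevant off-diagonal entry of row \<open>i\<close>, with indices
  read cyclically. The complementarity problem then couples only \<open>x\<^sub>i\<close> and \<open>x\<^sub>i\<^sub>+\<^sub>1\<close>, and every
  implication follows a solution once around the cycle. Where \<open>d\<^sub>i > 0\<close>, row \<open>i\<close> is solved by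
  \<open>x\<^sub>i = max 0 (- (b\<^sub>i x\<^sub>i\<^sub>+\<^sub>1 + q\<^sub>i) / d\<^sub>i)\<close>; going backwards from \<open>x\<^sub>k = t\<close> satisfies all rows except
  row \<open>k\<close>, which becomes a one-dimensional complementarity problem in \<open>t\<close> that the intermediate
  value theorem solves. If \<open>d\<^sub>k = 0\<close>, then going backwards from \<open>x\<^sub>k = 1\<close> with \<open>q = 0\<close> contradicts
  \<open>R\<^sub>0\<close> unless every other row has signs \<open>(+,-)\<close>. Going forwards, a suitable sign pattern of \<open>q\<close>
  forces positivity of one component to propagate to the next one, until a nonnegative row is
  violated.
\<close>

section \<open>The complementarity problem of a bdsw matrix in cyclic coordinates\<close>

text \<open>Reading indices modulo \<open>n\<close> puts the corner entry of the last row on the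
  same footing as the superdiagonal entries, so that row needs no separate treatment.\<close>

definition cyc_lcp ::
  "nat \<Rightarrow> (nat \<Rightarrow> real) \<Rightarrow> (nat \<Rightarrow> real) \<Rightarrow> (nat \<Rightarrow> real) \<Rightarrow> (nat \<Rightarrow> real) \<Rightarrow> bool" where
  "cyc_lcp n d b q x \<longleftrightarrow> (\<forall>i<n. x i \<ge> 0 \<and> d i * x i + b i * x (Suc i mod n) + q i \<ge> 0 \<and>
     x i * (d i * x i + b i * x (Suc i mod n) + q i) = 0)"

lemma cyc_lcpD:
  assumes "cyc_lcp n d b q x" "i < n"
  shows "x i \<ge> 0" "x (Suc i mod n) \<ge> 0"
    "d i * x i + b i * x (Suc i mod n) + q i \<ge> 0"
    "x i > 0 \<Longrightarrow> d i * x i + b i * x (Suc i mod n) + q i = 0"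
proof -
  have "Suc i mod n < n" using assms(2) by simp
  then show "x i \<ge> 0" "x (Suc i mod n) \<ge> 0"
    "d i * x i + b i * x (Suc i mod n) + q i \<ge> 0"
    "x i > 0 \<Longrightarrow> d i * x i + b i * x (Suc i mod n) + q i = 0"
    using assms unfolding cyc_lcp_def by fastforce+
qed

lemma cyc_lcp_cong:
  assumes "\<And>i. i < n \<Longrightarrow> q i = q' i" "\<And>i. i < n \<Longrightarrow> x i = x' i"
  shows "cyc_lcp n d b q x \<longleftrightarrow> cyc_lcp n d b q' x'"
proof -
  have "Suc i mod n < n" if "i < n" for i using that by simp
  then show ?thesis unfolding cyc_lcp_def using assms by simp
qed

lemma bdsw_mult_vec:
  assumes "bdsw n A" "x \<in> carrier_vec n" "i < n"
  shows "(A *\<^sub>v x) $ i = A $$ (i, i) * x $ i + offdiag n A i * x $ (Suc i mod n)"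
proof -
  have A: "A \<in> carrier_mat n n" "n \<ge> 2"
    and z: "\<And>j. j < n \<Longrightarrow> \<not> (j = i \<or> j = i + 1 \<or> (i = n - 1 \<and> j = 0)) \<Longrightarrow> A $$ (i, j) = 0"
    using assms unfolding bdsw_def by auto
  have off: "offdiag n A i = A $$ (i, Suc i mod n)"
    using assms(3) A(2) by (auto simp: offdiag_def mod_Suc)
  \<comment> \<open>Here \<open>n \<ge> 2\<close> keeps the two positions distinct, so that the sum
    below splits into two terms.\<close>
  have ne: "Suc i mod n \<noteq> i" "Suc i mod n < n" using assms(3) A(2) by (auto simp: mod_Suc)
  have "(A *\<^sub>v x) $ i = (\<Sum>j\<in>{0..<n}. A $$ (i, j) * x $ j)"
    using A assms by (simp add: scalar_prod_def)
  also have "\<dots> = (\<Sum>j\<in>{i, Suc i mod n}. A $$ (i, j) * x $ j)"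
  proof (rule sum.mono_neutral_right)
    show "\<forall>j\<in>{0..<n} - {i, Suc i mod n}. A $$ (i, j) * x $ j = 0"
    proof
      fix j assume j: "j \<in> {0..<n} - {i, Suc i mod n}"
      then have "A $$ (i, j) = 0"
        using assms(3) by (intro z) (auto simp: mod_Suc split: if_splits)
      then show "A $$ (i, j) * x $ j = 0" by simp
    qed
  qed (use assms(3) ne in auto)
  also have "\<dots> = A $$ (i, i) * x $ i + offdiag n A i * x $ (Suc i mod n)"
    using ne off by simp
  finally show ?thesis .
qed

lemma LCP_bdsw_iff:
  assumes "bdsw n A" "q \<in> carrier_vec n"
  shows "x \<in> LCP A q \<longleftrightarrow>
    x \<in> carrier_vec n \<and> cyc_lcp n (\<lambda>i. A $$ (i, i)) (offdiag n A) (($) q) (($) x)"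
proof (cases "x \<in> carrier_vec n")
  case True
  have A: "A \<in> carrier_mat n n" using assms unfolding bdsw_def by auto
  define w where "w i = A $$ (i, i) * x $ i + offdiag n A i * x $ (Suc i mod n) + q $ i" for i
  have w: "(A *\<^sub>v x + q) $ i = w i" if "i < n" for i
    using that bdsw_mult_vec[OF assms(1) True that] assms(2) A by (simp add: w_def)
  have sp: "x \<bullet> (A *\<^sub>v x + q) = (\<Sum>i\<in>{0..<n}. x $ i * w i)"
    using A assms(2) True unfolding scalar_prod_def by (auto intro!: sum.cong simp flip: w)
  have "x \<in> LCP A q \<longleftrightarrow> (\<forall>i<n. x $ i \<ge> 0) \<and> (\<forall>i<n. w i \<ge> 0) \<and> (\<Sum>i\<in>{0..<n}. x $ i * w i) = 0"
    using True assms(2) A w unfolding LCP_def sp[symmetric] by (auto simp: less_eq_vec_def)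
  \<comment> \<open>A vanishing sum of nonnegative products forces each product to vanish, so
    complementarity decouples into rows.\<close>
  also have "\<dots> \<longleftrightarrow> (\<forall>i<n. x $ i \<ge> 0) \<and> (\<forall>i<n. w i \<ge> 0) \<and> (\<forall>i<n. x $ i * w i = 0)"
    by (intro conj_cong refl) (subst sum_nonneg_eq_0_iff, auto simp del: mult_eq_0_iff)
  also have "\<dots> \<longleftrightarrow> cyc_lcp n (\<lambda>i. A $$ (i, i)) (offdiag n A) (($) q) (($) x)"
    unfolding cyc_lcp_def w_def by blast
  finally show ?thesis using True by simp
qed (use assms in \<open>auto simp: LCP_def\<close>)

lemma vec_LCP_bdsw_iff:
  assumes "bdsw n A"
  shows "vec n x \<in> LCP A (vec n q) \<longleftrightarrow> cyc_lcp n (\<lambda>i. A $$ (i, i)) (offdiag n A) q x"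
proof -
  have "cyc_lcp n (\<lambda>i. A $$ (i, i)) (offdiag n A) (($) (vec n q)) (($) (vec n x))
      \<longleftrightarrow> cyc_lcp n (\<lambda>i. A $$ (i, i)) (offdiag n A) q x"
    by (rule cyc_lcp_cong) auto
  then show ?thesis using assms by (simp add: LCP_bdsw_iff)
qed

lemma vec_index_id: "v \<in> carrier_vec n \<Longrightarrow> vec n (($) v) = v"
  by auto

lemma vec_eq_0_iff: "vec n x = 0\<^sub>v n \<longleftrightarrow> (\<forall>i<n. x i = 0)"
  by (auto simp: vec_eq_iff)

lemma Q_class_bdsw_iff:
  assumes "bdsw n A"
  shows "A \<in> Q_class n \<longleftrightarrow> (\<forall>q. \<exists>x. cyc_lcp n (\<lambda>i. A $$ (i, i)) (offdiag n A) q x)"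
    (is "_ \<longleftrightarrow> ?R")
proof
  assume Q: "A \<in> Q_class n"
  show ?R
  proof
    fix q
    obtain x where "x \<in> LCP A (vec n q)" using Q unfolding Q_class_def by fastforce
    moreover from this have "vec n (($) x) = x"
      using assms by (intro vec_index_id) (simp add: LCP_bdsw_iff)
    ultimately have "cyc_lcp n (\<lambda>i. A $$ (i, i)) (offdiag n A) q (($) x)"
      using vec_LCP_bdsw_iff[OF assms, of "($) x" q] by simp
    then show "\<exists>x. cyc_lcp n (\<lambda>i. A $$ (i, i)) (offdiag n A) q x" by blast
  qed
next
  assume R: ?R
  have "LCP A q \<noteq> {}" if "q \<in> carrier_vec n" for q
    using R vec_LCP_bdsw_iff[OF assms, of _ "($) q"] vec_index_id[OF that] by auto
  then show "A \<in> Q_class n" using assms by (auto simp: Q_class_def bdsw_def)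
qed

text \<open>For nonnegative \<open>q\<close> the zero vector always solves the problem, so only
  uniqueness is at stake. This serves both R_0 and E_0.\<close>

lemma LCP_bdsw_eq_zero_iff:
  assumes "bdsw n A" "\<And>i. i < n \<Longrightarrow> q i \<ge> 0"
  shows "LCP A (vec n q) = {0\<^sub>v n} \<longleftrightarrow>
    (\<forall>x. cyc_lcp n (\<lambda>i. A $$ (i, i)) (offdiag n A) q x \<longrightarrow> (\<forall>i<n. x i = 0))"
    (is "_ \<longleftrightarrow> ?R")
proof
  assume L: "LCP A (vec n q) = {0\<^sub>v n}"
  show ?R
    unfolding vec_LCP_bdsw_iff[OF assms(1), symmetric] vec_eq_0_iff[symmetric] L by simp
next
  assume R: ?R
  have "0\<^sub>v n \<in> LCP A (vec n q)"
    unfolding zero_vec_def vec_LCP_bdsw_iff[OF assms(1)] using assms(2) by (auto simp: cyc_lcp_def)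
  moreover have "v = 0\<^sub>v n" if "v \<in> LCP A (vec n q)" for v
  proof -
    have v: "vec n (($) v) = v"
      using that assms(1) by (intro vec_index_id) (simp add: LCP_bdsw_iff)
    then have "cyc_lcp n (\<lambda>i. A $$ (i, i)) (offdiag n A) q (($) v)"
      using that vec_LCP_bdsw_iff[OF assms(1), of "($) v" q] by simp
    then show ?thesis using R vec_eq_0_iff[of n "($) v"] v by simp
  qed
  ultimately show "LCP A (vec n q) = {0\<^sub>v n}" by blast
qed

lemma R0_class_bdsw_iff:
  assumes "bdsw n A"
  shows "A \<in> R0_class n \<longleftrightarrow>
    (\<forall>x. cyc_lcp n (\<lambda>i. A $$ (i, i)) (offdiag n A) (\<lambda>i. 0) x \<longrightarrow> (\<forall>i<n. x i = 0))"
  using assms LCP_bdsw_eq_zero_iff[OF assms, of "\<lambda>i. 0"]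
  by (auto simp: R0_class_def bdsw_def zero_vec_def)

lemma E0_class_bdsw_iff:
  assumes "bdsw n A"
  shows "A \<in> E0_class n \<longleftrightarrow> (\<forall>q. (\<forall>i<n. q i > 0) \<longrightarrow>
    (\<forall>x. cyc_lcp n (\<lambda>i. A $$ (i, i)) (offdiag n A) q x \<longrightarrow> (\<forall>i<n. x i = 0)))"
    (is "_ \<longleftrightarrow> ?R")
proof
  assume E: "A \<in> E0_class n"
  show ?R
  proof (intro allI impI)
    fix q x i assume q: "\<forall>i<n. q i > 0"
      and *: "cyc_lcp n (\<lambda>i. A $$ (i, i)) (offdiag n A) q x" "i < n"
    have "LCP A (vec n q) = {0\<^sub>v n}"
      using E q unfolding E0_class_def positive_vec_def by simp
    then show "x i = 0" using * q LCP_bdsw_eq_zero_iff[OF assms, of q] less_imp_le by blast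
  qed
next
  assume R: ?R
  have "LCP A q = {0\<^sub>v n}" if "q \<in> carrier_vec n" "positive_vec q" for q
  proof -
    have q: "\<forall>i<n. q $ i > 0" using that by (auto simp: positive_vec_def)
    then have "LCP A (vec n (($) q)) = {0\<^sub>v n}"
      using R by (subst LCP_bdsw_eq_zero_iff[OF assms]) (auto intro: less_imp_le)
    then show ?thesis unfolding vec_index_id[OF that(1)] .
  qed
  then show "A \<in> E0_class n" using assms by (auto simp: E0_class_def bdsw_def)
qed

section \<open>Induction around the cycle and backward substitution\<close>

text \<open>The walk starts just after \<open>i\<close> and reaches \<open>i\<close> last, so no
  step out of \<open>i\<close> is required. The case \<open>j = i\<close> carries a property all the
  way round.\<close>

lemma cyclic_induct:
  assumes "i < n" "j < n" "P (Suc i mod n)"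
    and step: "\<And>j. j < n \<Longrightarrow> j \<noteq> i \<Longrightarrow> P j \<Longrightarrow> P (Suc j mod n)"
  shows "P j"
proof -
  have *: "P ((i + Suc m) mod n)" if "m < n" for m
    using that
  proof (induction m)
    case 0
    then show ?case using assms(3) by simp
  next
    case (Suc m)
    have "(i + Suc m) mod n \<noteq> i"
    proof (cases "i + Suc m < n")
      case False
      then have "(i + Suc m) mod n = i + Suc m - n"
        using Suc.prems assms(1) by (simp add: mod_if)
      then show ?thesis using Suc.prems False by linarith
    qed simp
    then have "P (Suc ((i + Suc m) mod n) mod n)"
      using Suc assms(1) by (intro step) auto
    then show ?case by (simp add: mod_simps)
  qed
  show ?thesis
  proof (cases "i < j")
    case True
    then show ?thesis using *[of "j - Suc i"] assms(2) by simp
  next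
    case False
    then have "i + Suc (j + n - Suc i) = j + n" using assms(1) by simp
    then show ?thesis using *[of "j + n - Suc i"] False assms(1,2) by simp
  qed
qed

text \<open>The reflection \<open>i \<mapsto> k - i\<close> modulo \<open>n\<close>; it is an involution, so it serves both as the row
  treated in a given step and as the step that treats a given row.\<close>

definition refl_idx :: "nat \<Rightarrow> nat \<Rightarrow> nat \<Rightarrow> nat" where
  "refl_idx n k i = (if i \<le> k then k - i else k + n - i)"

lemma refl_idx_less: "k < n \<Longrightarrow> i < n \<Longrightarrow> refl_idx n k i < n"
  by (auto simp: refl_idx_def)

lemma refl_idx_invol: "k < n \<Longrightarrow> i < n \<Longrightarrow> refl_idx n k (refl_idx n k i) = i"
  by (auto simp: refl_idx_def)

text \<open>Component \<open>i\<close> is computed one step after its cyclic successor, the only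
  other component occurring in row \<open>i\<close>.\<close>

lemma refl_idx_Suc:
  "k < n \<Longrightarrow> i < n \<Longrightarrow> i \<noteq> k \<Longrightarrow> refl_idx n k i = Suc (refl_idx n k (Suc i mod n))"
  by (auto simp: refl_idx_def mod_Suc)

lemma refl_idx_next: "k < n \<Longrightarrow> refl_idx n k (Suc k mod n) = n - 1"
  by (auto simp: refl_idx_def mod_Suc)

text \<open>Backward substitution from \<open>x\<^sub>k = t\<close>. If \<open>d\<close> vanishes in some row, the division yields \<open>0\<close>.\<close>

primrec back_subst ::
  "nat \<Rightarrow> (nat \<Rightarrow> real) \<Rightarrow> (nat \<Rightarrow> real) \<Rightarrow> (nat \<Rightarrow> real) \<Rightarrow> nat \<Rightarrow> real \<Rightarrow> nat \<Rightarrow> real" where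
  "back_subst n d b q k t 0 = t"
| "back_subst n d b q k t (Suc l) = max 0
     (- (b (refl_idx n k (Suc l)) * back_subst n d b q k t l + q (refl_idx n k (Suc l))) /
       d (refl_idx n k (Suc l)))"

lemma back_subst_nonneg: "t \<ge> 0 \<Longrightarrow> back_subst n d b q k t l \<ge> 0"
  by (cases l) auto

lemma continuous_on_back_subst: "continuous_on S (\<lambda>t. back_subst n d b q k t l)"
  by (induction l) (auto simp: divide_inverse intro!: continuous_intros)

lemma back_subst_unbounded:
  assumes "k < n" and d: "\<And>i. i < n \<Longrightarrow> i \<noteq> k \<Longrightarrow> d i > 0 \<and> b i < 0" and "l < n"
  shows "\<exists>t\<ge>0. back_subst n d b q k t l \<ge> M"
  using assms(3)
proof (induction l arbitrary: M)
  case 0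
  show ?case by (rule exI[of _ "max 0 M"]) simp
next
  case (Suc l)
  define j where "j = refl_idx n k (Suc l)"
  have j: "j < n" "j \<noteq> k"
    using Suc.prems assms(1) by (auto simp: j_def refl_idx_def)
  then have db: "d j > 0" "b j < 0" using d by auto
  \<comment> \<open>The threshold solves \<open>- (b j * y + q j) / d j = M\<close> for
    \<open>y\<close>; the left side increases with \<open>y\<close> because
    \<open>b j < 0 < d j\<close>.\<close>
  obtain t where t: "t \<ge> 0" "back_subst n d b q k t l \<ge> (M * d j + q j) / (- b j)"
    using Suc by force
  then have "M \<le> - (b j * back_subst n d b q k t l + q j) / d j"
    using db by (simp add: field_simps)
  then have "M \<le> back_subst n d b q k t (Suc l)" by (simp flip: j_def)
  then show ?case using t(1) by blast
qed

text \<open>The maximum makes each row with positive diagonal complementary: either its slack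
  vanishes, or the component is 0 and the slack is \<open>b i * y + q i > 0\<close>, where
  \<open>y\<close> is the next component. In a row with zero diagonal the component is 0 and the
  sign conditions suffice. Only row \<open>k\<close> remains, and it involves the last computed
  value.\<close>

lemma cyc_lcp_back_subst:
  assumes kn: "k < n" and t: "0 \<le> t"
    and rows: "\<And>i. i < n \<Longrightarrow> i \<noteq> k \<Longrightarrow> d i > 0 \<or> (d i = 0 \<and> b i \<ge> 0 \<and> q i \<ge> 0)"
    and k: "d k * t + b k * back_subst n d b q k t (n - 1) + q k \<ge> 0"
      "t * (d k * t + b k * back_subst n d b q k t (n - 1) + q k) = 0"
  shows "cyc_lcp n d b q (\<lambda>i. back_subst n d b q k t (refl_idx n k i))"
proof -
  let ?x = "\<lambda>i. back_subst n d b q k t (refl_idx n k i)"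
  have "?x i \<ge> 0 \<and> d i * ?x i + b i * ?x (Suc i mod n) + q i \<ge> 0 \<and>
     ?x i * (d i * ?x i + b i * ?x (Suc i mod n) + q i) = 0" if i: "i < n" for i
  proof (cases "i = k")
    case True
    moreover have "refl_idx n k k = 0" by (simp add: refl_idx_def)
    ultimately show ?thesis using k t kn by (simp add: refl_idx_next)
  next
    case False
    define y where "y = ?x (Suc i mod n)"
    have y: "y \<ge> 0" unfolding y_def by (rule back_subst_nonneg[OF t])
    have "refl_idx n k (Suc (refl_idx n k (Suc i mod n))) = i"
      using refl_idx_Suc[OF kn i False] refl_idx_invol[OF kn i] by simp
    then have x: "?x i = max 0 (- (b i * y + q i) / d i)"
      using refl_idx_Suc[OF kn i False] by (simp add: y_def)
    show ?thesis
    proof (cases "d i > 0")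
      case True
      then show ?thesis unfolding y_def[symmetric] x
        by (auto simp: max_def field_simps)
    next
      case False
      then have "d i = 0" "b i \<ge> 0" "q i \<ge> 0" using rows i \<open>i \<noteq> k\<close> by auto
      then show ?thesis unfolding y_def[symmetric] x using y by simp
    qed
  qed
  then show ?thesis unfolding cyc_lcp_def by blast
qed

section \<open>Solvability for every right-hand side\<close>

lemma nonneg_complementarity_ivt:
  fixes h :: "real \<Rightarrow> real"
  assumes "continuous_on {0..T} h" "T \<ge> 0" "h T \<ge> 0"
  shows "\<exists>t\<ge>0. h t \<ge> 0 \<and> t * h t = 0"
proof (cases "h 0 \<ge> 0")
  case False
  then obtain t where "0 \<le> t" "h t = 0" using IVT'[of h 0 0 T] assms by auto
  then show ?thesis by (intro exI[of _ t]) simp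
qed (auto intro: exI[of _ 0])

lemma cyc_lcp_solvable:
  assumes kn: "k < n" and b: "b k \<ge> 0"
    and d: "\<And>i. i < n \<Longrightarrow> i \<noteq> k \<Longrightarrow> d i > 0"
    and alt: "d k > 0 \<or> (d k = 0 \<and> b k > 0 \<and> (\<forall>i<n. i \<noteq> k \<longrightarrow> b i < 0))"
  shows "\<exists>x. cyc_lcp n d b q x"
proof -
  define h where "h t = d k * t + b k * back_subst n d b q k t (n - 1) + q k" for t
  have "\<exists>T\<ge>0. h T \<ge> 0"
  proof (cases "d k > 0")
    case True
    \<comment> \<open>With this \<open>T\<close> the diagonal term outweighs a negative
      \<open>q k\<close>, and the off-diagonal term only helps.\<close>
    define T where "T = \<bar>q k\<bar> / d k"
    have T: "T \<ge> 0" "d k * T = \<bar>q k\<bar>" using True by (auto simp: T_def)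
    have "b k * back_subst n d b q k T (n - 1) \<ge> 0" using b back_subst_nonneg[OF T(1)] by simp
    then show ?thesis using T by (intro exI[of _ T]) (simp add: h_def)
  next
    case False
    then have dk: "d k = 0" "b k > 0" and "\<And>i. i < n \<Longrightarrow> i \<noteq> k \<Longrightarrow> d i > 0 \<and> b i < 0"
      using alt d by auto
    then obtain T where T: "T \<ge> 0" "back_subst n d b q k T (n - 1) \<ge> - q k / b k"
      using back_subst_unbounded[OF kn, of d b "n - 1" "- q k / b k" q] kn by auto
    then show ?thesis using dk by (intro exI[of _ T]) (simp add: h_def field_simps)
  qed
  then obtain T where T: "T \<ge> 0" "h T \<ge> 0" by blast
  have "continuous_on {0..T} h"
    unfolding h_def by (intro continuous_intros continuous_on_back_subst)
  then obtain t where "t \<ge> 0" "h t \<ge> 0" "t * h t = 0"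
    using nonneg_complementarity_ivt T by blast
  then show ?thesis using cyc_lcp_back_subst[OF kn, of t d b q] d unfolding h_def by blast
qed

text \<open>The test vector \<open>q\<close> is -1 at \<open>i\<close>, which forces the component
  after \<open>i\<close> to be positive. In every later row, \<open>d j * x j\<close> and
  \<open>q j\<close> cannot cancel, so tightness makes the next component positive too. A
  nonnegative row other than \<open>i\<close> has \<open>q j = 1\<close> and cannot be tight, a
  contradiction once positivity reaches it.\<close>

lemma cyc_lcp_solvable_imp:
  assumes solv: "\<And>q. \<exists>x. cyc_lcp n d b q x"
    and pos: "\<And>j. j < n \<Longrightarrow> d j > 0 \<or> b j > 0"
    and i: "i < n" "d i \<le> 0" and j: "j < n" "j \<noteq> i"
  shows "\<not> (d j \<ge> 0 \<and> b j \<ge> 0)"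
proof -
  define q where "q j = (if j \<noteq> i \<and> (d j > 0 \<or> b j \<ge> 0 \<and> d j \<ge> 0) then 1 else - 1 :: real)" for j
  obtain x where x: "cyc_lcp n d b q x" using solv by blast
  have row: "\<not> (d j \<ge> 0 \<and> b j \<ge> 0)" if "j < n" "j \<noteq> i" "x j > 0" for j
  proof
    assume "d j \<ge> 0 \<and> b j \<ge> 0"
    then have "d j * x j \<ge> 0" "b j * x (Suc j mod n) \<ge> 0" "q j = 1"
      using that cyc_lcpD(2)[OF x] by (auto simp: q_def)
    then show False using cyc_lcpD(4)[OF x] that by force
  qed
  have "x j > 0"
  proof (rule cyclic_induct[of i n j "\<lambda>j. x j > 0"])
    have "d i * x i \<le> 0" using i cyc_lcpD(1)[OF x] by (simp add: mult_nonpos_nonneg)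
    then have "b i * x (Suc i mod n) > 0" using cyc_lcpD(3)[OF x i(1)] by (simp add: q_def)
    then show "x (Suc i mod n) > 0" using cyc_lcpD(2)[OF x i(1)]
      by (cases "x (Suc i mod n) = 0") auto
  next
    fix j assume j: "j < n" "j \<noteq> i" "x j > 0"
    have w: "d j * x j + b j * x (Suc j mod n) + q j = 0" using cyc_lcpD(4)[OF x] j by blast
    have "d j * x j + q j \<noteq> 0"
    proof (cases "d j > 0")
      case True
      then have "q j = 1" "d j * x j > 0" using j by (auto simp: q_def)
      then show ?thesis by simp
    next
      case False
      then have "q j = - 1" "d j * x j \<le> 0"
        using row[OF j] pos[OF j(1)] j by (auto simp: q_def mult_nonpos_nonneg)
      then show ?thesis by simp
    qed
    then have "x (Suc j mod n) \<noteq> 0" using w by auto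
    then show "x (Suc j mod n) > 0" using cyc_lcpD(2)[OF x j(1)] by simp
  qed (use i j in auto)
  then show ?thesis using row j by blast
qed

section \<open>Uniqueness of the zero solution\<close>

text \<open>A tight row with positive diagonal and \<open>q j \<ge> 0\<close> needs a nonzero next
  component to balance it. Hence a nonzero component would spread forwards to
  \<open>k\<close>.\<close>

lemma cyc_lcp_eq_zero:
  assumes x: "cyc_lcp n d b q x" and q: "\<And>i. i < n \<Longrightarrow> q i \<ge> 0"
    and d: "\<And>i. i < n \<Longrightarrow> i \<noteq> k \<Longrightarrow> d i > 0"
    and k: "k < n" "x k = 0" and i: "i < n"
  shows "x i = 0"
proof (rule ccontr)
  assume "x i \<noteq> 0"
  have step: "x (Suc j mod n) \<noteq> 0" if "j < n" "x j \<noteq> 0" for j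
  proof
    assume z: "x (Suc j mod n) = 0"
    have xj: "x j > 0" using that cyc_lcpD(1)[OF x that(1)] by simp
    \<comment> \<open>\<open>j\<close> differs from \<open>k\<close>, since
      \<open>x k = 0\<close>.\<close>
    have "d j > 0" using d that k by metis
    then have "d j * x j > 0" using xj by simp
    then show False using cyc_lcpD(4)[OF x that(1) xj] z q[OF that(1)] by simp
  qed
  then have "x k \<noteq> 0"
    using cyclic_induct[of i n k "\<lambda>j. x j \<noteq> 0"] \<open>x i \<noteq> 0\<close> i k(1) by blast
  then show False using k by simp
qed

text \<open>A positive \<open>x k\<close> would leave strictly positive slack in row
  \<open>k\<close>. The alternative \<open>d k > 0\<close> serves R_0, and \<open>q k > 0\<close>
  serves E_0.\<close>

lemma cyc_lcp_nonneg_row_zero: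
  assumes x: "cyc_lcp n d b q x" and k: "k < n" "b k \<ge> 0" "d k \<ge> 0" "q k \<ge> 0"
    and "d k > 0 \<or> q k > 0"
  shows "x k = 0"
proof (rule ccontr)
  assume "x k \<noteq> 0"
  then have xk: "x k > 0" using cyc_lcpD(1)[OF x k(1)] by simp
  have "d k * x k + q k > 0"
    using xk k assms(6)
    by (metis add_nonneg_pos add_pos_nonneg less_imp_le mult_nonneg_nonneg mult_pos_pos)
  moreover have "b k * x (Suc k mod n) \<ge> 0" using k cyc_lcpD(2)[OF x k(1)] by simp
  ultimately show False using cyc_lcpD(4)[OF x k(1) xk] by simp
qed

text \<open>In the homogeneous problem zeros propagate forwards through rows with negative off-diagonal
  entry.\<close>

lemma cyc_lcp_zero_diag_zero:
  assumes x: "cyc_lcp n d b (\<lambda>i. 0) x"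
    and k: "k < n" "d k = 0" "b k > 0"
    and b: "\<And>i. i < n \<Longrightarrow> i \<noteq> k \<Longrightarrow> b i < 0"
  shows "x k = 0"
proof (rule ccontr)
  assume "x k \<noteq> 0"
  then have "x k > 0" using cyc_lcpD(1)[OF x k(1)] by simp
  then have next_zero: "x (Suc k mod n) = 0" using cyc_lcpD(4)[OF x k(1)] k by simp
  have "x (Suc j mod n) = 0" if "j < n" "j \<noteq> k" "x j = 0" for j
  proof -
    have "b j * x (Suc j mod n) \<ge> 0" using cyc_lcpD(3)[OF x that(1)] that by simp
    then have "x (Suc j mod n) \<le> 0" using b[OF that(1,2)] by (simp add: zero_le_mult_iff)
    then show ?thesis using cyc_lcpD(2)[OF x that(1)] by simp
  qed
  then have "x k = 0" using cyclic_induct[of k n k "\<lambda>j. x j = 0"] next_zero k(1) by blast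
  then show False using \<open>x k \<noteq> 0\<close> by simp
qed

lemma cyc_lcp_E0_imp_diag_nonneg:
  assumes "n \<ge> 2" "i < n"
    and E0: "\<And>q x. (\<And>j. j < n \<Longrightarrow> q j > 0) \<Longrightarrow> cyc_lcp n d b q x \<Longrightarrow> x i = 0"
  shows "d i \<ge> 0"
proof (rule ccontr)
  assume di: "\<not> d i \<ge> 0"
  \<comment> \<open>The unit vector at \<open>i\<close> is a forbidden solution:
    \<open>- d i\<close> makes row \<open>i\<close> tight, and \<open>1 + \<bar>b j\<bar>\<close>
    keeps every other row positive.\<close>
  define x where "x j = (if j = i then 1 else 0 :: real)" for j
  define q where "q j = (if j = i then - d i else 1 + \<bar>b j\<bar>)" for j
  have "Suc i mod n \<noteq> i" using assms(1,2) by (auto simp: mod_Suc)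
  then have "cyc_lcp n d b q x" unfolding cyc_lcp_def by (auto simp: x_def q_def)
  moreover have "q j > 0" for j using di by (auto simp: q_def)
  ultimately have "x i = 0" using E0 by blast
  then show False by (simp add: x_def)
qed

lemma cyc_lcp_R0_imp_signs:
  assumes R0: "\<And>x. cyc_lcp n d b (\<lambda>i. 0) x \<Longrightarrow> x k = 0"
    and d: "\<And>i. i < n \<Longrightarrow> d i \<ge> 0"
    and pos: "\<And>i. i < n \<Longrightarrow> d i > 0 \<or> b i > 0"
    and k: "k < n" "d k = 0" and j: "j < n" "j \<noteq> k"
  shows "d j > 0 \<and> b j < 0"
proof -
  define y where "y = back_subst n d b (\<lambda>i. 0) k 1"
  have y0: "y l \<ge> 0" for l unfolding y_def by (rule back_subst_nonneg) simp
  \<comment> \<open>If the last value were 0, row \<open>k\<close> would read 0 = 0 and the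
    substitution would give a homogeneous solution with \<open>x k = 1\<close>.\<close>
  have last: "y (n - 1) \<noteq> 0"
  proof
    assume "y (n - 1) = 0"
    moreover have "d i > 0 \<or> (d i = 0 \<and> b i \<ge> 0)" if "i < n" for i
      using pos[OF that] d[OF that] by auto
    ultimately have "cyc_lcp n d b (\<lambda>i. 0) (\<lambda>i. y (refl_idx n k i))"
      unfolding y_def using k by (intro cyc_lcp_back_subst) auto
    then have "y (refl_idx n k k) = 0" using R0 by blast
    then show False by (simp add: y_def refl_idx_def)
  qed
  \<comment> \<open>With \<open>q = 0\<close> a zero value produces only zeros, so the nonzero last
    value makes all values nonzero.\<close>
  have down: "y l \<noteq> 0" if "y (Suc l) \<noteq> 0" for l
    using that by (auto simp: y_def)
  have nz: "y l \<noteq> 0" if "l \<le> n - 1" for l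
    using that
  proof (induction rule: inc_induct)
    case base
    show ?case by (rule last)
  next
    case (step l)
    then show ?case using down by blast
  qed
  have "refl_idx n k j < n" using k j refl_idx_less by simp
  moreover obtain l where l: "refl_idx n k j = Suc l" using refl_idx_Suc k j by blast
  ultimately have "y (Suc l) > 0"
    using y0[of "Suc l"] nz[of "Suc l"] by linarith
  moreover have "refl_idx n k (Suc l) = j" using refl_idx_invol[of k n j] k j l by simp
  \<comment> \<open>Division by zero gives 0, so this positivity excludes \<open>d j = 0\<close> and
    then fixes the sign of \<open>b j\<close>.\<close>
  ultimately have *: "- (b j * y l) / d j > 0" by (simp add: y_def less_max_iff_disj)
  then have "d j > 0" using d[OF j(1)] by (cases "d j = 0") auto
  then have "b j * y l < 0" using * by (simp add: divide_less_0_iff)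
  then show ?thesis using \<open>d j > 0\<close> y0[of l] by (auto simp: mult_less_0_iff)
qed

section \<open>The equivalences for Type-I bdsw matrices\<close>

theorem theorem5p3:
  fixes n k :: nat and A :: "real mat"
  assumes "n \<ge> 2"
    and "type_I_bdsw n A"
    and every_row_has_positive_entry: "\<forall>i < n. \<exists>j < n. A $$ (i, j) > 0"
    and "A $$ (n - 1, 0) < 0"
    and "A $$ (n - 1, n - 1) > 0"
    and "k < n" and "k \<noteq> n - 1" and "nonneg_row A k"
  shows "(A \<in> Q_class n \<longleftrightarrow>
            (\<forall>i < n. A $$ (i, i) > 0) \<or>
            (A $$ (k, k) = 0 \<and> A $$ (k, k + 1) > 0 \<and>
              (\<forall>i < n. i \<noteq> k \<longrightarrow> A $$ (i, i) > 0 \<and> offdiag n A i < 0)))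
       \<and> ((\<forall>i < n. A $$ (i, i) > 0) \<or>
            (A $$ (k, k) = 0 \<and> A $$ (k, k + 1) > 0 \<and>
              (\<forall>i < n. i \<noteq> k \<longrightarrow> A $$ (i, i) > 0 \<and> offdiag n A i < 0))
          \<longleftrightarrow> A \<in> Rstar_class n)"
proof -
  have A: "bdsw n A" using assms(2) by (simp add: type_I_bdsw_def)
  define d where "d i = A $$ (i, i)" for i
  define b where "b = offdiag n A"
  have kn: "k < n" by fact
  have bk: "b k = A $$ (k, k + 1)" using assms(7) by (simp add: b_def offdiag_def)
  have pos: "d i > 0 \<or> b i > 0" if i: "i < n" for i
  proof -
    obtain j where j: "j < n" "A $$ (i, j) > 0" using every_row_has_positive_entry i by blast
    then have "j = i \<or> j = i + 1 \<or> (i = n - 1 \<and> j = 0)"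
      using A i unfolding bdsw_def by fastforce
    then show ?thesis using j i by (auto simp: d_def b_def offdiag_def)
  qed
  have nonneg: "d k \<ge> 0" "b k \<ge> 0"
    using assms(6-8) A
    by (auto simp: nonneg_row_def less_eq_vec_def bdsw_def d_def bk)
  let ?ii = "(\<forall>i<n. d i > 0) \<or> (d k = 0 \<and> b k > 0 \<and> (\<forall>i<n. i \<noteq> k \<longrightarrow> d i > 0 \<and> b i < 0))"
  have Q: "A \<in> Q_class n \<longleftrightarrow> (\<forall>q. \<exists>x. cyc_lcp n d b q x)"
    using Q_class_bdsw_iff[OF A] by (simp add: d_def[abs_def] b_def)
  have R0: "A \<in> R0_class n \<longleftrightarrow> (\<forall>x. cyc_lcp n d b (\<lambda>i. 0) x \<longrightarrow> (\<forall>i<n. x i = 0))"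
    using R0_class_bdsw_iff[OF A] by (simp add: d_def[abs_def] b_def)
  have E0: "A \<in> E0_class n \<longleftrightarrow> (\<forall>q. (\<forall>i<n. q i > 0) \<longrightarrow>
      (\<forall>x. cyc_lcp n d b q x \<longrightarrow> (\<forall>i<n. x i = 0)))"
    using E0_class_bdsw_iff[OF A] by (simp add: d_def[abs_def] b_def)
  have Q_if: "A \<in> Q_class n" if ?ii
  proof -
    have "\<exists>x. cyc_lcp n d b q x" for q
      by (rule cyc_lcp_solvable[where k = k]) (use that kn nonneg in auto)
    then show ?thesis using Q by blast
  qed
  have Q_only_if: ?ii if "A \<in> Q_class n"
  proof (cases "\<forall>i<n. d i > 0")
    case False
    then obtain i where i: "i < n" "d i \<le> 0" by fastforce
    have *: "\<not> (d j \<ge> 0 \<and> b j \<ge> 0)" if "j < n" "j \<noteq> m" "m < n" "d m \<le> 0" for j m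
      using cyc_lcp_solvable_imp[of n d b m j] Q \<open>A \<in> Q_class n\<close> pos that by blast
    \<comment> \<open>A nonpositive diagonal entry outside row \<open>k\<close> would forbid the
      nonnegative row \<open>k\<close>.\<close>
    have uniq: "m = k" if "m < n" "d m \<le> 0" for m using *[of k m] nonneg kn that by blast
    then have dk: "d k = 0" using i nonneg by force
    have "d j > 0 \<and> b j < 0" if "j < n" "j \<noteq> k" for j
      using uniq[of j] *[of j k] that dk kn by force
    then show ?thesis using dk pos[OF kn] by auto
  qed simp
  have Rstar_if: "A \<in> Rstar_class n" if ii: ?ii
  proof -
    have d: "\<And>i. i < n \<Longrightarrow> i \<noteq> k \<Longrightarrow> d i > 0" using ii by auto
    \<comment> \<open>The first lemma covers a positive diagonal, the second the case
      \<open>d k = 0\<close>.\<close>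
    have "x k = 0" if "cyc_lcp n d b (\<lambda>i. 0) x" for x
      using ii cyc_lcp_nonneg_row_zero[OF that kn nonneg(2,1)]
        cyc_lcp_zero_diag_zero[OF that kn] kn by auto
    then have "A \<in> R0_class n"
      unfolding R0 using cyc_lcp_eq_zero[of n d b "\<lambda>i. 0" _ k] d kn by auto
    moreover have "x i = 0"
      if q: "\<forall>i<n. q i > 0" and x: "cyc_lcp n d b q x" and i: "i < n" for q x i
    proof -
      have "q i \<ge> 0" if "i < n" for i using q that less_imp_le by blast
      then show ?thesis
        using cyc_lcp_nonneg_row_zero[OF x kn nonneg(2,1)] cyc_lcp_eq_zero[OF x _ d kn _ i] q kn
        by blast
    qed
    ultimately show ?thesis unfolding Rstar_class_def Int_iff E0 by blast
  qed
  have Rstar_only_if: ?ii if "A \<in> Rstar_class n"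
  proof (cases "\<forall>i<n. d i > 0")
    case False
    have R: "A \<in> R0_class n" "A \<in> E0_class n" using that by (auto simp: Rstar_class_def)
    have d: "d i \<ge> 0" if "i < n" for i
      using cyc_lcp_E0_imp_diag_nonneg[OF assms(1) that] R(2) that unfolding E0 by blast
    obtain i where i: "i < n" "d i = 0" using False d by force
    have signs: "d j > 0 \<and> b j < 0" if "j < n" "j \<noteq> i" for j
      by (rule cyc_lcp_R0_imp_signs[where k = i and n = n])
        (use d pos i that R(1) in \<open>auto simp: R0\<close>)
    \<comment> \<open>All rows except \<open>i\<close> have a negative off-diagonal entry, whereas
      \<open>b k \<ge> 0\<close>.\<close>
    then have "i = k" using nonneg kn by force
    then show ?thesis using signs i pos[OF i(1)] by auto
  qed simp
  show ?thesis
    using Q_if Q_only_if Rstar_if Rstar_only_if unfolding bk[symmetric] d_def b_def by blast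
qed

end
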